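(* Let $h=h(\hat x,\hat p)$ be a self-adjoint operator on $L^2(\mathbb{R})$ that is an analytic function of the quadrature operators $\hat x,\hat p$, let $\omega=e^{-ih}$, let $d$ be a positive integer, let $\vec\theta=(\theta_0,\dots,\theta_d)\in\mathbb{R}^{d+1}$, and let $$Q_{\vec\theta}(\omega) = e^{i\theta_d\hat\sigma_x}\, W_z e^{i\theta_{d-1}\hat\sigma_x}\cdots W_z e^{i\theta_0\hat\sigma_x}=\begin{bmatrix} F(\omega) & iG(\omega)\\ iG(1/\omega) & F(1/\omega)\end{bmatrix},\qquad W_z=\begin{bmatrix}\omega&0\\0&\omega^{-1}\end{bmatrix},$$ with $F(\omega)=\sum_n f_n\omega^n$, $G(\omega)=\sum_n g_n\omega^n$, $f_n,g_n\in\mathbb{R}$, $n\in\{-d,-d+2,\dots,d\}$. Let $S_\beta=e^{ih_\beta(\hat x,\hat p)}$ be a unitary on $L^2(\mathbb{R})$, where $h_\beta(\hat x,\hat p)$ is a finite-degree Hermitian polynomial of the quadrature operators parameterized by $\beta\in\mathbb{R}$. Then the operator realized by the degree-$d$ QSP interferometry protocol is a linear combination of $(d+1)^2$ elementary transformations: $$Q_{\vec\theta}^{-1}(\omega)\,S_\beta\,Q_{\vec\theta}(\omega)=\sum_{n,m} C_{nm}\, S_{\beta,nm}(\hat x,\hat p),\qquad S_{\beta,nm}(\hat x,\hat p):=\omega^{-n}S_\beta\,\omega^{m},$$ where $n,m$ each range over $\{-d,-d+2,\dots,d\}$ and $C_{nm}$ is the complex $2\times2$ matrix (acting on the qubit)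 $$C_{nm}=\begin{bmatrix} f_nf_m+g_{-n}g_{-m} & i\,(f_ng_m-g_{-n}f_{-m})\\ i\,(f_{-n}g_{-m}-g_nf_m) & g_ng_m+f_{-n}f_{-m}\end{bmatrix}.$$
   Context: The system is a qubit coupled to a bosonic oscillator, with Hilbert space $\mathbb{C}^2\otimes L^2(\mathbb{R})$; operators are written as $2\times2$ block matrices (indexed by the qubit's computational basis) with entries operators on $L^2(\mathbb{R})$. $\hat x,\hat p$ are the canonical position and momentum operators. $\hat\sigma_x=\begin{bmatrix}0&1\\1&0\end{bmatrix}$ is the Pauli matrix on the qubit, and $e^{i\theta\hat\sigma_x}$ acts as the identity on the oscillator. $1/\omega$ denotes $\omega^{-1}$. In $Q_{\vec\theta}^{-1}S_\beta Q_{\vec\theta}$, $S_\beta$ stands for $I\otimes S_\beta$ (it acts trivially on the qubit). The product $C_{nm}S_{\beta,nm}$ means the $2\times2$ block matrix whose $(i,j)$ entry is the scalar $(C_{nm})_{ij}$ times the operator $S_{\beta,nm}$. It may be taken as known that $Q_{\vec\theta}(\omega)$ has the displayed block form with real coefficients $f_n,g_n$ depending on $\vec\theta$ and supported on $n\in\{-d,-d+2,\dots,d\}$. *)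

theory Defs
  imports "HOL-Analysis.Analysis"
begin

section \<open>The Hilbert space of square-integrable complex functions on the real line\<close>

definition square_integrable :: "(real \<Rightarrow> complex) \<Rightarrow> bool" where
  "square_integrable f \<longleftrightarrow>
     f \<in> borel_measurable lborel \<and> integrable lborel (\<lambda>x. (cmod (f x))\<^sup>2)"

definition L2_rel :: "(real \<Rightarrow> complex) \<Rightarrow> (real \<Rightarrow> complex) \<Rightarrow> bool" where
  "L2_rel f g \<longleftrightarrow> square_integrable f \<and> square_integrable g \<and> (AE x in lborel. f x = g x)"

lemma square_integrable_0: "square_integrable (\<lambda>_. 0)"
  by (simp add: square_integrable_def)

lemma square_integrable_add:
  assumes "square_integrable f" "square_integrable g"
  shows "square_integrable (\<lambda>x. f x + g x)"
proof -
  have [measurable]: "f \<in> borel_measurable lborel" "g \<in> borel_measurable lborel"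
    using assms by (auto simp: square_integrable_def)
  have i: "integrable lborel (\<lambda>x. 2 * (cmod (f x))\<^sup>2 + 2 * (cmod (g x))\<^sup>2)"
    using assms by (auto simp: square_integrable_def)
  have b: "(cmod (f x + g x))\<^sup>2 \<le> 2 * (cmod (f x))\<^sup>2 + 2 * (cmod (g x))\<^sup>2" for x
  proof -
    have "(cmod (f x + g x))\<^sup>2 \<le> (cmod (f x) + cmod (g x))\<^sup>2"
      by (intro power_mono norm_triangle_ineq) auto
    also have "\<dots> \<le> 2 * (cmod (f x))\<^sup>2 + 2 * (cmod (g x))\<^sup>2"
      using sum_squares_bound[of "cmod (f x)" "cmod (g x)"] by (simp add: power2_sum)
    finally show ?thesis .
  qed
  have "integrable lborel (\<lambda>x. (cmod (f x + g x))\<^sup>2)"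
    by (rule Bochner_Integration.integrable_bound[OF i]) (use b in auto)
  then show ?thesis by (simp add: square_integrable_def)
qed

lemma square_integrable_cmult:
  assumes "square_integrable f"
  shows "square_integrable (\<lambda>x. c * f x)"
  using assms by (auto simp: square_integrable_def norm_mult power_mult_distrib)

lemma square_integrable_scaleR:
  assumes "square_integrable f"
  shows "square_integrable (\<lambda>x. r *\<^sub>R f x)"
  using square_integrable_cmult[OF assms, of "of_real r"] by (simp add: scaleR_conv_of_real)

lemma borel_measurable_cnj_mult:
  assumes "f \<in> borel_measurable M" "g \<in> borel_measurable M"
  shows "(\<lambda>x. cnj (f x) * g x :: complex) \<in> borel_measurable M"
proof -
  have "cnj \<in> borel_measurable borel"
    by (intro borel_measurable_continuous_onI continuous_on_cnj continuous_on_id)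
  then have "(\<lambda>x. cnj (f x)) \<in> borel_measurable M"
    using assms(1) measurable_compose by blast
  then show ?thesis using assms(2) by (rule borel_measurable_times)
qed

lemma integrable_cnj_mult:
  assumes "square_integrable f" "square_integrable g"
  shows "integrable lborel (\<lambda>x. cnj (f x) * g x)"
proof -
  have [measurable]: "f \<in> borel_measurable lborel" "g \<in> borel_measurable lborel"
    using assms by (auto simp: square_integrable_def)
  have i: "integrable lborel (\<lambda>x. (cmod (f x))\<^sup>2 + (cmod (g x))\<^sup>2)"
    using assms by (auto simp: square_integrable_def)
  have b: "cmod (f x) * cmod (g x) \<le> (cmod (f x))\<^sup>2 + (cmod (g x))\<^sup>2" for x
  proof -
    have "0 \<le> cmod (f x) * cmod (g x)" by simp
    then show ?thesis
      using sum_squares_bound[of "cmod (f x)" "cmod (g x)"] by linarith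
  qed
  show ?thesis
    by (rule Bochner_Integration.integrable_bound[OF i])
      (use b in \<open>auto simp: norm_mult intro!: borel_measurable_cnj_mult[of _ lborel, simplified]\<close>)
qed

quotient_type L2 = "real \<Rightarrow> complex" / partial: L2_rel
proof (rule part_equivpI)
  show "\<exists>x. L2_rel x x"
    by (rule exI[of _ "\<lambda>_. 0"]) (simp add: L2_rel_def square_integrable_0)
  show "symp L2_rel"
    by (auto simp: symp_def L2_rel_def elim: eventually_mono)
  show "transp L2_rel"
    unfolding transp_def L2_rel_def by (auto elim: eventually_elim2)
qed

instantiation L2 :: ab_group_add
begin

lift_definition zero_L2 :: L2 is "\<lambda>_. 0"
  by (simp add: L2_rel_def square_integrable_0)

lift_definition plus_L2 :: "L2 \<Rightarrow> L2 \<Rightarrow> L2" is "\<lambda>f g x. f x + g x"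
  by (auto simp: L2_rel_def square_integrable_add)

lift_definition uminus_L2 :: "L2 \<Rightarrow> L2" is "\<lambda>f x. - f x"
  by (auto simp: L2_rel_def square_integrable_cmult[of _ "-1", simplified])

definition minus_L2 :: "L2 \<Rightarrow> L2 \<Rightarrow> L2" where
  "minus_L2 \<psi> \<phi> = \<psi> + - \<phi>"

instance
proof
  fix a b c :: L2
  show "a + b + c = a + (b + c)"
    by transfer (simp add: L2_rel_def square_integrable_add add.assoc)
  show "a + b = b + a"
    by transfer (simp add: L2_rel_def square_integrable_add add.commute)
  show "0 + a = a"
    by transfer (simp add: L2_rel_def)
  show "- a + a = 0"
    by transfer (simp add: L2_rel_def square_integrable_0)
  show "a - b = a + - b"
    by (simp add: minus_L2_def)
qed

end

lift_definition scaleC :: "complex \<Rightarrow> L2 \<Rightarrow> L2"  (infixr "*\<^sub>C" 75) is "\<lambda>c f x. c * f x"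
  by (auto simp: L2_rel_def square_integrable_cmult)

text \<open>Conjugate-linear in the first argument.\<close>

lift_definition cinner :: "L2 \<Rightarrow> L2 \<Rightarrow> complex" is "\<lambda>f g. LINT x|lborel. cnj (f x) * g x"
proof -
  fix f1 f2 g1 g2
  assume a: "L2_rel f1 f2" "L2_rel g1 g2"
  then have [measurable]: "f1 \<in> borel_measurable lborel" "g1 \<in> borel_measurable lborel"
     "f2 \<in> borel_measurable lborel" "g2 \<in> borel_measurable lborel"
    by (auto simp: L2_rel_def square_integrable_def)
  show "(LINT x|lborel. cnj (f1 x) * g1 x) = (LINT x|lborel. cnj (f2 x) * g2 x)"
  proof (rule integral_cong_AE)
    show "(\<lambda>x. cnj (f1 x) * g1 x) \<in> borel_measurable lborel"
      "(\<lambda>x. cnj (f2 x) * g2 x) \<in> borel_measurable lborel"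
      by (intro borel_measurable_cnj_mult; measurable)+
    have "AE x in lborel. f1 x = f2 x" "AE x in lborel. g1 x = g2 x"
      using a by (auto simp: L2_rel_def)
    then show "AE x in lborel. cnj (f1 x) * g1 x = cnj (f2 x) * g2 x"
      by eventually_elim simp
  qed
qed

text \<open>The real Hilbert space structure underlying the complex one; it supplies norm and topology.\<close>

instantiation L2 :: real_inner
begin

definition scaleR_L2 :: "real \<Rightarrow> L2 \<Rightarrow> L2" where
  "scaleR_L2 r \<psi> = of_real r *\<^sub>C \<psi>"

definition inner_L2 :: "L2 \<Rightarrow> L2 \<Rightarrow> real" where
  "inner_L2 \<psi> \<phi> = Re (cinner \<psi> \<phi>)"

definition norm_L2 :: "L2 \<Rightarrow> real" where
  "norm_L2 \<psi> = sqrt (inner \<psi> \<psi>)"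

definition dist_L2 :: "L2 \<Rightarrow> L2 \<Rightarrow> real" where
  "dist_L2 \<psi> \<phi> = norm (\<psi> - \<phi>)"

definition sgn_L2 :: "L2 \<Rightarrow> L2" where
  "sgn_L2 \<psi> = inverse (norm \<psi>) *\<^sub>R \<psi>"

definition uniformity_L2 :: "(L2 \<times> L2) filter" where
  "uniformity_L2 = (INF e\<in>{0<..}. principal {(x, y). dist x y < e})"

definition open_L2 :: "L2 set \<Rightarrow> bool" where
  "open_L2 U \<longleftrightarrow> (\<forall>x\<in>U. \<forall>\<^sub>F (x', y) in uniformity. x' = x \<longrightarrow> y \<in> U)"

lemma cinner_self_L2:
  "\<exists>r\<ge>0. cinner \<psi> \<psi> = complex_of_real r \<and> (r = 0 \<longleftrightarrow> \<psi> = 0)"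
proof transfer
  fix f assume f: "L2_rel f f"
  define r where "r = (LINT x|lborel. (cmod (f x))\<^sup>2)"
  have i: "integrable lborel (\<lambda>x. (cmod (f x))\<^sup>2)"
    using f by (auto simp: L2_rel_def square_integrable_def)
  have e: "cnj (f x) * f x = complex_of_real ((cmod (f x))\<^sup>2)" for x
    using complex_norm_square[of "f x"] by (simp add: mult.commute)
  have 1: "(LINT x|lborel. cnj (f x) * f x) = complex_of_real r"
    unfolding e r_def by (rule integral_complex_of_real)
  have 2: "r \<ge> 0" by (simp add: r_def)
  have "r = 0 \<longleftrightarrow> (AE x in lborel. (cmod (f x))\<^sup>2 = 0)"
    unfolding r_def by (rule integral_nonneg_eq_0_iff_AE[OF i]) auto
  then have 3: "r = 0 \<longleftrightarrow> L2_rel f (\<lambda>_. 0)"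
    using f by (simp add: L2_rel_def square_integrable_0)
  show "\<exists>r\<ge>0. (LINT x|lborel. cnj (f x) * f x) = complex_of_real r \<and>
          (r = 0 \<longleftrightarrow> L2_rel f (\<lambda>_. 0))"
    using 1 2 3 by blast
qed

instance
proof
  fix a b c :: L2 and r s :: real
  show "r *\<^sub>R (a + b) = r *\<^sub>R a + r *\<^sub>R b"
    unfolding scaleR_L2_def
    by transfer (simp add: L2_rel_def square_integrable_add square_integrable_cmult distrib_left)
  show "(r + s) *\<^sub>R a = r *\<^sub>R a + s *\<^sub>R a"
    unfolding scaleR_L2_def
    by transfer (simp add: L2_rel_def square_integrable_add square_integrable_cmult
        distrib_right square_integrable_scaleR)
  show "r *\<^sub>R s *\<^sub>R a = (r * s) *\<^sub>R a"
    unfolding scaleR_L2_def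
    by transfer (simp add: L2_rel_def square_integrable_cmult mult.assoc)
  show "1 *\<^sub>R a = a"
    unfolding scaleR_L2_def by transfer (simp add: L2_rel_def)
  show "sgn a = inverse (norm a) *\<^sub>R a" by (rule sgn_L2_def)
  show "dist a b = norm (a - b)" by (rule dist_L2_def)
  show "(uniformity :: (L2 \<times> L2) filter) = (INF e\<in>{0<..}. principal {(x, y). dist x y < e})"
    by (rule uniformity_L2_def)
  show "open U \<longleftrightarrow> (\<forall>x\<in>U. \<forall>\<^sub>F (x', y) in uniformity. x' = x \<longrightarrow> y \<in> U)" for U :: "L2 set"
    by (rule open_L2_def)
  have "cinner b a = cnj (cinner a b)"
  proof transfer
    fix f g
    show "(LINT x|lborel. cnj (g x) * f x) = cnj (LINT x|lborel. cnj (f x) * g x)"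
      by (simp add: mult.commute flip: Bochner_Integration.integral_cnj)
  qed
  then show "inner a b = inner b a" by (simp add: inner_L2_def)
  have "cinner (a + b) c = cinner a c + cinner b c"
  proof transfer
    fix f g k assume "L2_rel f f" "L2_rel g g" "L2_rel k k"
    then have "integrable lborel (\<lambda>x. cnj (f x) * k x)" "integrable lborel (\<lambda>x. cnj (g x) * k x)"
      by (auto simp: L2_rel_def intro: integrable_cnj_mult)
    then show "(LINT x|lborel. cnj (f x + g x) * k x)
        = (LINT x|lborel. cnj (f x) * k x) + (LINT x|lborel. cnj (g x) * k x)"
      by (simp add: distrib_right)
  qed
  then show "inner (a + b) c = inner a c + inner b c" by (simp add: inner_L2_def)
  have "cinner (r *\<^sub>R a) b = of_real r * cinner a b"
    unfolding scaleR_L2_def by transfer (simp add: mult.assoc)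
  then show "inner (r *\<^sub>R a) b = r * inner a b" by (simp add: inner_L2_def)
  show "0 \<le> inner a a" and "inner a a = 0 \<longleftrightarrow> a = 0"
    using cinner_self_L2[of a] by (auto simp: inner_L2_def)
  show "norm a = sqrt (inner a a)" by (rule norm_L2_def)
qed

end

section \<open>Unbounded operators, self-adjointness, exponentials\<close>

text \<open>An unbounded operator is represented by its graph; its domain is \<^const>\<open>Domain\<close> of the
  graph, and inclusion of graphs is extension of operators.\<close>

type_synonym unbounded_op = "(L2 \<times> L2) set"

definition op_scaleC :: "complex \<Rightarrow> unbounded_op \<Rightarrow> unbounded_op" where
  "op_scaleC c A = {(\<psi>, c *\<^sub>C \<xi>) | \<psi> \<xi>. (\<psi>, \<xi>) \<in> A}"

definition densely_defined :: "unbounded_op \<Rightarrow> bool" where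
  "densely_defined A \<longleftrightarrow> closure (Domain A) = UNIV"

definition adjoint_op :: "unbounded_op \<Rightarrow> unbounded_op" where
  "adjoint_op A = {(\<phi>, \<eta>). \<forall>(\<psi>, \<xi>)\<in>A. cinner \<phi> \<xi> = cinner \<eta> \<psi>}"

text \<open>A self-adjoint graph is automatically a linear subspace, and the graph of a function because
  the adjoint of a densely defined operator is single-valued.\<close>

definition self_adjoint :: "unbounded_op \<Rightarrow> bool" where
  "self_adjoint A \<longleftrightarrow> densely_defined A \<and> adjoint_op A = A"

definition symmetric_op :: "unbounded_op \<Rightarrow> bool" where
  "symmetric_op A \<longleftrightarrow> densely_defined A \<and> A \<subseteq> adjoint_op A"

definition bounded_op :: "(L2 \<Rightarrow> L2) \<Rightarrow> bool" where
  "bounded_op U \<longleftrightarrow> bounded_linear U \<and> (\<forall>c \<psi>. U (c *\<^sub>C \<psi>) = c *\<^sub>C U \<psi>)"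

definition C0_group :: "(real \<Rightarrow> L2 \<Rightarrow> L2) \<Rightarrow> bool" where
  "C0_group T \<longleftrightarrow> (\<forall>t. bounded_op (T t)) \<and> T 0 = id \<and> (\<forall>s t. T (s + t) = T s \<circ> T t) \<and>
     (\<forall>\<psi>. continuous_on UNIV (\<lambda>t. T t \<psi>))"

definition generator :: "(real \<Rightarrow> L2 \<Rightarrow> L2) \<Rightarrow> unbounded_op" where
  "generator T = {(\<psi>, \<xi>). ((\<lambda>t. (T t \<psi> - \<psi>) /\<^sub>R t) \<longlongrightarrow> \<xi>) (at 0)}"

text \<open>\<open>has_op_exp A U\<close> says that \<open>U\<close> is the exponential of \<open>A\<close>, for an unbounded \<open>A\<close>: the value
  at time 1 of the (unique) strongly continuous one-parameter group generated by \<open>A\<close>. By Stone's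
  theorem such a \<open>U\<close> exists whenever \<open>A\<close> is \<open>\<plusminus>\<i>\<close> times a self-adjoint operator; unitarity
  of \<open>U\<close> is then a consequence and not part of the definition.\<close>

definition has_op_exp :: "unbounded_op \<Rightarrow> (L2 \<Rightarrow> L2) \<Rightarrow> bool" where
  "has_op_exp A U \<longleftrightarrow> (\<exists>T. C0_group T \<and> generator T = A \<and> U = T 1)"

section \<open>Quadrature operators and functions of them\<close>

text \<open>Position, on its maximal domain.\<close>

lift_definition is_position :: "L2 \<Rightarrow> L2 \<Rightarrow> bool" is
  "\<lambda>f g. AE x in lborel. g x = of_real x * f x"
proof -
  fix f1 f2 g1 g2
  assume "L2_rel f1 f2" "L2_rel g1 g2"
  then have "AE x in lborel. f1 x = f2 x" "AE x in lborel. g1 x = g2 x"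
    by (auto simp: L2_rel_def)
  then have "AE x in lborel. (g1 x = of_real x * f1 x) = (g2 x = of_real x * f2 x)"
    by eventually_elim simp
  then show "(AE x in lborel. g1 x = of_real x * f1 x) = (AE x in lborel. g2 x = of_real x * f2 x)"
    by (rule eventually_cong)
qed

text \<open>Momentum \<open>-\<i> d/dx\<close> (with \<open>\<hbar> = 1\<close>), on the Sobolev space \<open>H\<^sup>1\<close>: the state has an
  absolutely continuous representative \<open>F\<close> whose derivative is \<open>\<i>\<close> times the image
  \<open>g\<close>.\<close>

lift_definition is_momentum :: "L2 \<Rightarrow> L2 \<Rightarrow> bool" is
  "\<lambda>f g. \<exists>F. (AE x in lborel. F x = f x) \<and>
           (\<forall>a b. a \<le> b \<longrightarrow> F b - F a = (LINT x:{a..b}|lborel. \<i> * g x))"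
proof -
  fix f1 f2 g1 g2
  assume a: "L2_rel f1 f2" "L2_rel g1 g2"
  then have [measurable]: "g1 \<in> borel_measurable lborel" "g2 \<in> borel_measurable lborel"
    by (auto simp: L2_rel_def square_integrable_def)
  from a have f: "AE x in lborel. f1 x = f2 x" and g: "AE x in lborel. g1 x = g2 x"
    by (auto simp: L2_rel_def)
  have i: "(LINT x:{a..b}|lborel. \<i> * g1 x) = (LINT x:{a..b}|lborel. \<i> * g2 x)" for a b :: real
    unfolding set_lebesgue_integral_def
    by (rule integral_cong_AE) (use g in auto)
  have F: "(AE x in lborel. F x = f1 x) = (AE x in lborel. F x = f2 x)" for F
  proof (rule eventually_cong)
    show "AE x in lborel. (F x = f1 x) = (F x = f2 x)" using f by eventually_elim simp
  qed
  show "(\<exists>F. (AE x in lborel. F x = f1 x) \<and>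
           (\<forall>a b. a \<le> b \<longrightarrow> F b - F a = (LINT x:{a..b}|lborel. \<i> * g1 x))) =
        (\<exists>F. (AE x in lborel. F x = f2 x) \<and>
           (\<forall>a b. a \<le> b \<longrightarrow> F b - F a = (LINT x:{a..b}|lborel. \<i> * g2 x)))"
    unfolding i F ..
qed

datatype quadrature = Xhat | Phat

primrec quadrature_op :: "quadrature \<Rightarrow> unbounded_op" where
  "quadrature_op Xhat = {(\<psi>, \<xi>). is_position \<psi> \<xi>}"
| "quadrature_op Phat = {(\<psi>, \<xi>). is_momentum \<psi> \<xi>}"

text \<open>Since \<open>x\<close> and \<open>p\<close> do not commute, monomials in them are words; the last letter of the word
  acts first.\<close>

primrec word_op :: "quadrature list \<Rightarrow> unbounded_op" where
  "word_op [] = Id"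
| "word_op (q # w) = word_op w O quadrature_op q"

text \<open>The series \<open>\<Sum>\<^sub>w c\<^sub>w w(x, p)\<close>, summed by total degree, acting on those vectors on which
  every word is defined (the Schwartz space) and on which the series converges in norm. When \<open>c\<close>
  has finite support this is the polynomial with coefficients \<open>c\<close>, acting on the Schwartz space.\<close>

definition quadrature_series :: "(quadrature list \<Rightarrow> complex) \<Rightarrow> unbounded_op" where
  "quadrature_series c = {(\<psi>, \<xi>). \<exists>\<phi>. (\<forall>w. (\<psi>, \<phi> w) \<in> word_op w) \<and>
     (\<lambda>N. \<Sum>w | length w \<le> N. c w *\<^sub>C \<phi> w) \<longlonglongrightarrow> \<xi>}"

text \<open>\<open>h\<close> extends a power series in the quadratures that converges on a dense set of vectors.\<close>

definition analytic_in_quadratures :: "unbounded_op \<Rightarrow> bool" where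
  "analytic_in_quadratures h \<longleftrightarrow>
     (\<exists>c. densely_defined (quadrature_series c) \<and> quadrature_series c \<subseteq> h)"

definition hermitian_polynomial :: "(quadrature list \<Rightarrow> complex) \<Rightarrow> bool" where
  "hermitian_polynomial c \<longleftrightarrow> finite {w. c w \<noteq> 0} \<and> symmetric_op (quadrature_series c)"

section \<open>The qubit-oscillator system\<close>

text \<open>The Hilbert space of the joint system is \<^typ>\<open>L2 ^ 2\<close>, the orthogonal sum of two copies of
  the oscillator space indexed by the computational basis.\<close>

definition mat2 :: "'a \<Rightarrow> 'a \<Rightarrow> 'a \<Rightarrow> 'a \<Rightarrow> 'a ^ 2 ^ 2" where
  "mat2 a b c d = (\<chi> i j. if i = 1 then (if j = 1 then a else b) else (if j = 1 then c else d))"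

definition block_op :: "(L2 \<Rightarrow> L2) ^ 2 ^ 2 \<Rightarrow> L2 ^ 2 \<Rightarrow> L2 ^ 2" where
  "block_op B \<Psi> = (\<chi> i. \<Sum>j\<in>UNIV. (B $ i $ j) (\<Psi> $ j))"

definition tensor_op :: "complex ^ 2 ^ 2 \<Rightarrow> (L2 \<Rightarrow> L2) \<Rightarrow> L2 ^ 2 \<Rightarrow> L2 ^ 2" where
  "tensor_op M U = block_op (\<chi> i j. (\<lambda>\<psi>. (M $ i $ j) *\<^sub>C U \<psi>))"

definition sigma_x :: "complex ^ 2 ^ 2" where
  "sigma_x = mat2 0 1 1 0"

definition mat_exp :: "complex ^ 2 ^ 2 \<Rightarrow> complex ^ 2 ^ 2" where
  "mat_exp M = (\<Sum>n. (((**) M ^^ n) (mat 1)) /\<^sub>R fact n)"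

definition W_z :: "(L2 \<Rightarrow> L2) \<Rightarrow> L2 ^ 2 \<Rightarrow> L2 ^ 2" where
  "W_z \<omega> = block_op (mat2 \<omega> (\<lambda>_. 0) (\<lambda>_. 0) (inv \<omega>))"

definition rot_x :: "real \<Rightarrow> L2 ^ 2 \<Rightarrow> L2 ^ 2" where
  "rot_x \<theta> = tensor_op (mat_exp (mat (\<i> * of_real \<theta>) ** sigma_x)) id"

text \<open>Only \<open>\<theta> 0, \<dots>, \<theta> d\<close> enter \<open>qsp \<theta> \<omega> d\<close>.\<close>

primrec qsp :: "(nat \<Rightarrow> real) \<Rightarrow> (L2 \<Rightarrow> L2) \<Rightarrow> nat \<Rightarrow> L2 ^ 2 \<Rightarrow> L2 ^ 2" where
  "qsp \<theta> \<omega> 0 = rot_x (\<theta> 0)"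
| "qsp \<theta> \<omega> (Suc k) = rot_x (\<theta> (Suc k)) \<circ> W_z \<omega> \<circ> qsp \<theta> \<omega> k"

definition qsp_index :: "nat \<Rightarrow> int set" where
  "qsp_index d = {2 * int k - int d | k. k \<le> d}"

definition op_powi :: "(L2 \<Rightarrow> L2) \<Rightarrow> int \<Rightarrow> L2 \<Rightarrow> L2" where
  "op_powi U n = (if 0 \<le> n then U ^^ nat n else inv U ^^ nat (- n))"

definition laurent :: "nat \<Rightarrow> (int \<Rightarrow> real) \<Rightarrow> (L2 \<Rightarrow> L2) \<Rightarrow> L2 \<Rightarrow> L2" where
  "laurent d f U \<psi> = (\<Sum>n\<in>qsp_index d. f n *\<^sub>R op_powi U n \<psi>)"

definition qsp_block_form ::
    "nat \<Rightarrow> (int \<Rightarrow> real) \<Rightarrow> (int \<Rightarrow> real) \<Rightarrow> (L2 \<Rightarrow> L2) \<Rightarrow> L2 ^ 2 \<Rightarrow> L2 ^ 2" where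
  "qsp_block_form d f g \<omega> = block_op (mat2
     (laurent d f \<omega>)                    (\<lambda>\<psi>. \<i> *\<^sub>C laurent d g \<omega> \<psi>)
     (\<lambda>\<psi>. \<i> *\<^sub>C laurent d g (inv \<omega>) \<psi>)  (laurent d f (inv \<omega>)))"

definition C_mat :: "(int \<Rightarrow> real) \<Rightarrow> (int \<Rightarrow> real) \<Rightarrow> int \<Rightarrow> int \<Rightarrow> complex ^ 2 ^ 2" where
  "C_mat f g n m = mat2
     (of_real (f n * f m + g (- n) * g (- m)))
     (\<i> * of_real (f n * g m - g (- n) * f (- m)))
     (\<i> * of_real (f (- n) * g (- m) - g n * f m))
     (of_real (g n * g m + f (- n) * f (- m)))"

definition S_elem :: "(L2 \<Rightarrow> L2) \<Rightarrow> (L2 \<Rightarrow> L2) \<Rightarrow> int \<Rightarrow> int \<Rightarrow> L2 \<Rightarrow> L2" where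
  "S_elem \<omega> S n m = op_powi \<omega> (- n) \<circ> S \<circ> op_powi \<omega> m"

end

theory Submission
  imports Defs
begin

text \<open>The factors of \<open>Q\<close> are \<open>2 \<times> 2\<close> matrices over a commutative algebra of operators, the
  bicommutant of \<open>\<omega>\<close>. Both \<open>e\<^bsup>i\<theta>\<sigma>\<^esup>\<close> and \<open>W\<^sub>z\<close> have determinant 1 over this algebra, hence so has their
  product \<open>Q\<close>, and \<open>Q\<^sup>-\<^sup>1\<close> is the adjugate of the given block form. This argument applies even when
  \<open>\<omega>\<close> satisfies an algebraic relation, so that the block form does not determine the
  coefficients. Multiplying out and replacing \<open>n\<close> by \<open>-n\<close> where necessary gives \<open>C\<^bsub>nm\<^esub>\<close>.\<close>

section \<open>Complex linear operators\<close>

lemma scaleC_add_right: "c *\<^sub>C (x + y) = c *\<^sub>C x + c *\<^sub>C y"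
  by transfer (simp add: L2_rel_def square_integrable_add square_integrable_cmult distrib_left)

lemma scaleC_add_left: "(b + c) *\<^sub>C x = b *\<^sub>C x + c *\<^sub>C x"
  by transfer (simp add: L2_rel_def square_integrable_add square_integrable_cmult
      flip: distrib_right)

lemma scaleC_scaleC: "b *\<^sub>C c *\<^sub>C x = (b * c) *\<^sub>C x"
  by transfer (simp add: L2_rel_def square_integrable_cmult mult.assoc)

lemma scaleC_one: "1 *\<^sub>C x = x"
  by transfer (simp add: L2_rel_def)

lemma scaleC_zero_left: "0 *\<^sub>C x = 0"
  using scaleC_add_left[of 0 0 x] by simp

lemma scaleC_zero_right: "c *\<^sub>C 0 = 0"
  using scaleC_add_right[of c 0 0] by simp

lemma scaleC_minus_left: "(- c) *\<^sub>C x = - (c *\<^sub>C x)"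
  using scaleC_add_left[of "- c" c x] by (simp add: scaleC_zero_left eq_neg_iff_add_eq_0)

lemma scaleC_diff_left: "(b - c) *\<^sub>C x = b *\<^sub>C x - c *\<^sub>C x"
  using scaleC_add_left[of b "- c" x] by (simp add: scaleC_minus_left)

lemma scaleC_minus_right: "c *\<^sub>C (- x) = - (c *\<^sub>C x)"
  using scaleC_add_right[of c "- x" x] by (simp add: scaleC_zero_right eq_neg_iff_add_eq_0)

lemma scaleC_diff_right: "c *\<^sub>C (x - y) = c *\<^sub>C x - c *\<^sub>C y"
  using scaleC_add_right[of c x "- y"] by (simp add: scaleC_minus_right)

lemma scaleC_sum_right: "c *\<^sub>C (\<Sum>i\<in>I. x i) = (\<Sum>i\<in>I. c *\<^sub>C x i)"
  by (induction I rule: infinite_finite_induct) (auto simp: scaleC_zero_right scaleC_add_right)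

text \<open>Linearity in the algebraic sense, without continuity, so that closure under inverses of
  bijections is pure algebra.\<close>

definition clinear_op :: "(L2 \<Rightarrow> L2) \<Rightarrow> bool" where
  "clinear_op U \<longleftrightarrow> (\<forall>x y. U (x + y) = U x + U y) \<and> (\<forall>c x. U (c *\<^sub>C x) = c *\<^sub>C U x)"

lemma clinear_op_add: "clinear_op U \<Longrightarrow> U (x + y) = U x + U y"
  and clinear_op_scaleC: "clinear_op U \<Longrightarrow> U (c *\<^sub>C x) = c *\<^sub>C U x"
  by (auto simp: clinear_op_def)

lemma clinear_op_zero: "clinear_op U \<Longrightarrow> U 0 = 0"
  using clinear_op_scaleC[of U 0 0] by (simp add: scaleC_zero_left)

lemma clinear_op_minus: "clinear_op U \<Longrightarrow> U (- x) = - U x"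
  using clinear_op_scaleC[of U "- 1" x] by (simp add: scaleC_minus_left scaleC_one)

lemma clinear_op_diff: "clinear_op U \<Longrightarrow> U (x - y) = U x - U y"
  using clinear_op_add[of U x "- y"] by (simp add: clinear_op_minus)

lemma clinear_op_sum: "clinear_op U \<Longrightarrow> U (\<Sum>i\<in>I. x i) = (\<Sum>i\<in>I. U (x i))"
  by (induction I rule: infinite_finite_induct) (auto simp: clinear_op_zero clinear_op_add)

lemma clinear_op_id: "clinear_op id"
  by (simp add: clinear_op_def)

lemma clinear_op_comp: "clinear_op U \<Longrightarrow> clinear_op V \<Longrightarrow> clinear_op (U \<circ> V)"
  by (simp add: clinear_op_def)

lemma clinear_op_funpow: "clinear_op U \<Longrightarrow> clinear_op (U ^^ n)"
  by (induction n) (auto simp: clinear_op_id clinear_op_comp)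

lemma clinear_op_inv:
  assumes "clinear_op U" "bij U"
  shows "clinear_op (inv U)"
  unfolding clinear_op_def
proof (intro conjI allI)
  note s = surj_f_inv_f[OF bij_is_surj[OF assms(2)]]
  fix x y c
  show "inv U (x + y) = inv U x + inv U y"
    by (rule inv_f_eq[OF bij_is_inj[OF assms(2)]]) (simp add: clinear_op_add[OF assms(1)] s)
  show "inv U (c *\<^sub>C x) = c *\<^sub>C inv U x"
    by (rule inv_f_eq[OF bij_is_inj[OF assms(2)]]) (simp add: clinear_op_scaleC[OF assms(1)] s)
qed

lemma has_op_exp_clinear:
  assumes "has_op_exp A U"
  shows "clinear_op U"
  using assms
  by (auto simp: has_op_exp_def C0_group_def bounded_op_def clinear_op_def bounded_linear_def
      dest: linear_add)

text \<open>The group law makes \<open>T (- 1)\<close> a two-sided inverse of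
  \<open>T 1\<close>.\<close>

lemma has_op_exp_bij:
  assumes "has_op_exp A U"
  shows "bij U"
proof -
  obtain T :: "real \<Rightarrow> L2 \<Rightarrow> L2" where T: "T 0 = id" "\<And>s t. T (s + t) = T s \<circ> T t" "U = T 1"
    using assms by (auto simp: has_op_exp_def C0_group_def)
  show ?thesis
    using T(2)[of 1 "- 1"] T(2)[of "- 1" 1] T(1,3) by (intro o_bij[of "T (- 1)"]) auto
qed

section \<open>The commutative algebra generated by an operator\<close>

text \<open>Commutants are taken among all complex linear maps, bounded or not. This gives an
  algebra that contains \<open>U\<close>, and its inverse if \<open>U\<close> is bijective, without
  an explicit description of its elements.\<close>

definition bicommutant :: "(L2 \<Rightarrow> L2) \<Rightarrow> (L2 \<Rightarrow> L2) set" where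
  "bicommutant U = {X. clinear_op X \<and>
     (\<forall>Y. clinear_op Y \<longrightarrow> (\<forall>x. Y (U x) = U (Y x)) \<longrightarrow> (\<forall>x. Y (X x) = X (Y x)))}"

lemma bicommutant_clinear: "X \<in> bicommutant U \<Longrightarrow> clinear_op X"
  by (simp add: bicommutant_def)

text \<open>As \<open>U\<close> commutes with itself, it is a legitimate test operator for
  \<open>X\<close>. Hence \<open>X\<close> commutes with \<open>U\<close> and is in turn a test
  operator for \<open>Y\<close>.\<close>

lemma bicommutant_commute:
  assumes "clinear_op U" "X \<in> bicommutant U" "Y \<in> bicommutant U"
  shows "X (Y x) = Y (X x)"
proof -
  have "\<forall>x. X (U x) = U (X x)"
    using assms(1,2) by (auto simp: bicommutant_def)
  then show ?thesis
    using assms(2,3) by (auto simp: bicommutant_def)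
qed

lemma bicommutant_self: "clinear_op U \<Longrightarrow> U \<in> bicommutant U"
  by (simp add: bicommutant_def)

lemma bicommutant_inv:
  assumes "clinear_op U" "bij U"
  shows "inv U \<in> bicommutant U"
  unfolding bicommutant_def
proof (intro CollectI conjI allI impI)
  show "clinear_op (inv U)" using assms by (rule clinear_op_inv)
  fix Y x assume "\<forall>x. Y (U x) = U (Y x)"
  then have "U (Y (inv U x)) = Y x"
    using surj_f_inv_f[OF bij_is_surj[OF assms(2)]] by metis
  then show "Y (inv U x) = inv U (Y x)"
    using inv_f_eq[OF bij_is_inj[OF assms(2)]] by metis
qed

text \<open>Scalars are central because every test operator is complex linear.\<close>

lemma bicommutant_scalar: "(\<lambda>x. c *\<^sub>C x) \<in> bicommutant U"
  by (auto simp: bicommutant_def clinear_op_def scaleC_add_right scaleC_scaleC mult.commute)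

lemma bicommutant_zero: "(\<lambda>_. 0) \<in> bicommutant U"
  using bicommutant_scalar[of 0 U] by (simp add: scaleC_zero_left)

lemma bicommutant_add:
  "X \<in> bicommutant U \<Longrightarrow> Y \<in> bicommutant U \<Longrightarrow> (\<lambda>x. X x + Y x) \<in> bicommutant U"
  by (auto simp: bicommutant_def clinear_op_def scaleC_add_right algebra_simps)

lemma bicommutant_comp:
  "X \<in> bicommutant U \<Longrightarrow> Y \<in> bicommutant U \<Longrightarrow> (\<lambda>x. X (Y x)) \<in> bicommutant U"
  by (auto simp: bicommutant_def clinear_op_def)

section \<open>Block operators of determinant one\<close>

definition vec2 :: "L2 \<Rightarrow> L2 \<Rightarrow> L2 ^ 2" where
  "vec2 x y = (\<chi> i. if i = 1 then x else y)"

lemma vec2_eq_iff: "vec2 x y = vec2 x' y' \<longleftrightarrow> x = x' \<and> y = y'"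
  by (auto simp: vec2_def vec_eq_iff forall_2)

lemma vec2_nth: "vec2 x y $ 1 = x" "vec2 x y $ 2 = y"
  by (simp_all add: vec2_def)

lemma block_op_mat2:
  "block_op (mat2 a b c e) \<Psi> = vec2 (a (\<Psi> $ 1) + b (\<Psi> $ 2)) (c (\<Psi> $ 1) + e (\<Psi> $ 2))"
  by (simp add: block_op_def mat2_def vec2_def vec_eq_iff forall_2 sum_2)

lemma tensor_op_mat2:
  "tensor_op (mat2 a b c e) U \<Psi> =
     vec2 (a *\<^sub>C U (\<Psi> $ 1) + b *\<^sub>C U (\<Psi> $ 2)) (c *\<^sub>C U (\<Psi> $ 1) + e *\<^sub>C U (\<Psi> $ 2))"
  by (simp add: tensor_op_def block_op_def mat2_def vec2_def vec_eq_iff forall_2 sum_2)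

text \<open>The product of the algebra is composition, so the last conjunct is the condition that
  the determinant be 1. For linear \<open>U\<close> the entries commute, and the order of the
  factors is immaterial.\<close>

definition unimodular_over :: "(L2 \<Rightarrow> L2) \<Rightarrow> (L2 ^ 2 \<Rightarrow> L2 ^ 2) \<Rightarrow> bool" where
  "unimodular_over U Q \<longleftrightarrow> (\<exists>a\<in>bicommutant U. \<exists>b\<in>bicommutant U. \<exists>c\<in>bicommutant U.
     \<exists>e\<in>bicommutant U. Q = block_op (mat2 a b c e) \<and> (\<forall>x. a (e x) - b (c x) = x))"

text \<open>Multiplicativity of the determinant for matrices with commuting entries, carried out by
  hand on operators.\<close>

lemma unimodular_over_comp:
  assumes U: "clinear_op U" and "unimodular_over U P" "unimodular_over U Q"
  shows "unimodular_over U (P \<circ> Q)"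
proof -
  from assms obtain a b c e where
    P: "P = block_op (mat2 a b c e)" "\<And>x. a (e x) - b (c x) = x"
    and m: "a \<in> bicommutant U" "b \<in> bicommutant U" "c \<in> bicommutant U" "e \<in> bicommutant U"
    unfolding unimodular_over_def by blast
  from assms obtain a' b' c' e' where
    Q: "Q = block_op (mat2 a' b' c' e')" "\<And>x. a' (e' x) - b' (c' x) = x"
    and m': "a' \<in> bicommutant U" "b' \<in> bicommutant U" "c' \<in> bicommutant U" "e' \<in> bicommutant U"
    unfolding unimodular_over_def by blast
  note l = m[THEN bicommutant_clinear] m'[THEN bicommutant_clinear]
  note add = l[THEN clinear_op_add] and diff = l[THEN clinear_op_diff]
  note comm = bicommutant_commute[OF U]
  define A B C E where "A = (\<lambda>x. a (a' x) + b (c' x))" and "B = (\<lambda>x. a (b' x) + b (e' x))"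
    and "C = (\<lambda>x. c (a' x) + e (c' x))" and "E = (\<lambda>x. c (b' x) + e (e' x))"
  have "A \<in> bicommutant U" "B \<in> bicommutant U" "C \<in> bicommutant U" "E \<in> bicommutant U"
    unfolding A_def B_def C_def E_def by (intro bicommutant_add bicommutant_comp[OF m(1)]
      bicommutant_comp[OF m(2)] bicommutant_comp[OF m(3)] bicommutant_comp[OF m(4)] m')+
  moreover have "P \<circ> Q = block_op (mat2 A B C E)"
    by (rule ext) (simp add: P Q block_op_mat2 A_def B_def C_def E_def add vec2_nth vec2_eq_iff add_ac)
  moreover have "A (E x) - B (C x) = x" for x
  proof -
    \<comment> \<open>These instances are oriented as rewrite rules: unprimed letters move to the
      left of primed ones, and the pairs that occur within each group are sorted. The two mixed
      terms common to \<open>A E\<close> and \<open>B C\<close> then cancel.\<close>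
    note c' = comm[OF m'(1) m(1)] comm[OF m'(1) m(2)] comm[OF m'(1) m(3)] comm[OF m'(1) m(4)]
      comm[OF m'(2) m(1)] comm[OF m'(2) m(2)] comm[OF m'(2) m(3)] comm[OF m'(2) m(4)]
      comm[OF m'(3) m(1)] comm[OF m'(3) m(2)] comm[OF m'(3) m(3)] comm[OF m'(3) m(4)]
      comm[OF m'(4) m(1)] comm[OF m'(4) m(2)] comm[OF m'(4) m(3)] comm[OF m'(4) m(4)]
      comm[OF m(3) m(1)] comm[OF m(3) m(2)] comm[OF m(4) m(1)] comm[OF m(4) m(2)]
      comm[OF m'(2) m'(1)] comm[OF m'(4) m'(3)] comm[OF m'(3) m'(1)]
      comm[OF m'(3) m'(2)] comm[OF m'(4) m'(1)] comm[OF m'(4) m'(2)]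
    have "A (E x) - B (C x) =
      (a (e (a' (e' x) - b' (c' x))) - b (c (a' (e' x) - b' (c' x))))"
      unfolding A_def B_def C_def E_def
      by (simp only: add diff c') (simp add: algebra_simps)
    then show ?thesis by (simp add: P Q)
  qed
  ultimately show ?thesis unfolding unimodular_over_def by blast
qed

section \<open>The building blocks of the protocol\<close>

lemma unimodular_over_W_z:
  assumes "clinear_op \<omega>" "bij \<omega>"
  shows "unimodular_over \<omega> (W_z \<omega>)"
  unfolding unimodular_over_def W_z_def
  using assms bicommutant_self bicommutant_inv bicommutant_zero
  by (intro bexI[of _ \<omega>] bexI[of _ "\<lambda>_. 0"] bexI[of _ "inv \<omega>"])
    (auto simp: surj_f_inv_f bij_is_surj)

text \<open>The powers of \<open>x \<sigma>\<close> with \<open>\<sigma>\<^sup>2 = 1\<close> are split into the eigenvalues \<open>\<plusminus>x\<close>.\<close>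

lemma off_diagonal_funpow:
  fixes x :: complex
  shows "((**) (mat2 0 x x 0) ^^ n) (mat 1) =
    mat2 ((x ^ n + (- x) ^ n) / 2) ((x ^ n - (- x) ^ n) / 2)
         ((x ^ n - (- x) ^ n) / 2) ((x ^ n + (- x) ^ n) / 2)"
proof (induction n)
  case 0
  show ?case by (simp add: mat2_def mat_def vec_eq_iff forall_2)
next
  case (Suc n)
  have "mat2 0 x x 0 ** mat2 p q r s = mat2 (x * r) (x * s) (x * p) (x * q)" for p q r s
    by (simp add: mat2_def matrix_matrix_mult_def vec_eq_iff forall_2 sum_2)
  then show ?case
    by (simp only: funpow.simps o_apply Suc) (simp add: algebra_simps)
qed

text \<open>The entries are cosh x and sinh x; the exponential series for \<open>x\<close> and
  \<open>- x\<close> are combined entry by entry.\<close>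

lemma mat_exp_off_diagonal:
  fixes x :: complex
  shows "mat_exp (mat2 0 x x 0) =
    mat2 ((exp x + exp (- x)) / 2) ((exp x - exp (- x)) / 2)
         ((exp x - exp (- x)) / 2) ((exp x + exp (- x)) / 2)"
    (is "_ = ?R")
proof -
  have e: "(\<lambda>n. y ^ n /\<^sub>R fact n) sums exp y" for y :: complex
    by (rule exp_converges)
  have p: "(\<lambda>n. ((x ^ n + (- x) ^ n) / 2) /\<^sub>R fact n) sums ((exp x + exp (- x)) / 2)"
    using sums_divide[OF sums_add[OF e[of x] e[of "- x"]], of 2] by (simp add: scaleR_conv_of_real field_simps)
  have m: "(\<lambda>n. ((x ^ n - (- x) ^ n) / 2) /\<^sub>R fact n) sums ((exp x - exp (- x)) / 2)"
    using sums_divide[OF sums_diff[OF e[of x] e[of "- x"]], of 2] by (simp add: scaleR_conv_of_real field_simps)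
  have "(\<lambda>n. (((**) (mat2 0 x x 0) ^^ n) (mat 1)) /\<^sub>R fact n) sums ?R"
    unfolding sums_def off_diagonal_funpow
    by (intro vec_tendstoI) (use p m in \<open>auto simp: sums_def mat2_def\<close>)
  then show ?thesis
    unfolding mat_exp_def by (rule sums_unique[symmetric])
qed

text \<open>The entries are the scalars \<open>p\<close> = cosh x and \<open>m\<close> = sinh x at x
  = i \<theta>, that is, cos \<theta> and i sin \<theta>. The determinant is cosh^2 - sinh^2 =
  1.\<close>

lemma unimodular_over_rot_x: "unimodular_over \<omega> (rot_x \<theta>)"
proof -
  define x :: complex where "x = \<i> * of_real \<theta>"
  define p m where "p = (exp x + exp (- x)) / 2" and "m = (exp x - exp (- x)) / 2"
  have "mat x ** sigma_x = mat2 0 x x 0"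
    by (simp add: sigma_x_def mat2_def mat_def matrix_matrix_mult_def vec_eq_iff forall_2 sum_2)
  then have "rot_x \<theta> = tensor_op (mat2 p m m p) id"
    by (simp add: rot_x_def mat_exp_off_diagonal p_def m_def x_def)
  then have "rot_x \<theta> = block_op (mat2 (\<lambda>y. p *\<^sub>C y) (\<lambda>y. m *\<^sub>C y) (\<lambda>y. m *\<^sub>C y) (\<lambda>y. p *\<^sub>C y))"
    by (auto simp: tensor_op_mat2 block_op_mat2)
  moreover have "p * p - m * m = 1"
    unfolding p_def m_def by (simp add: field_simps exp_minus)
  then have "p *\<^sub>C p *\<^sub>C y - m *\<^sub>C m *\<^sub>C y = y" for y
    by (simp add: scaleC_scaleC scaleC_one flip: scaleC_diff_left)
  ultimately show ?thesis
    unfolding unimodular_over_def using bicommutant_scalar by blast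
qed

lemma unimodular_over_qsp:
  assumes "clinear_op \<omega>" "bij \<omega>"
  shows "unimodular_over \<omega> (qsp \<theta> \<omega> d)"
  using assms by (induction d)
    (auto intro!: unimodular_over_comp unimodular_over_rot_x unimodular_over_W_z)

section \<open>Inverse of a block operator of determinant one\<close>

text \<open>Vectors with one zero component isolate the columns. Vanishing at 0 excludes moving a
  constant from one entry of a row to the other.\<close>

lemma block_op_mat2_inject:
  assumes "block_op (mat2 a b c e) = block_op (mat2 a' b' c' e')"
    and "\<forall>X\<in>{a, b, c, e, a', b', c', e'}. X 0 = 0"
  shows "a = a' \<and> b = b' \<and> c = c' \<and> e = e'"
proof -
  have "block_op (mat2 a b c e) (vec2 x y) = block_op (mat2 a' b' c' e') (vec2 x y)" for x y
    using assms(1) by simp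
  then have "a x + b y = a' x + b' y \<and> c x + e y = c' x + e' y" for x y
    by (simp add: block_op_mat2 vec2_eq_iff) (simp add: vec2_def)
  from this[of _ 0] this[of 0] show ?thesis
    using assms(2) by (auto simp: fun_eq_iff)
qed

text \<open>The inverse is the adjugate. \<open>unimodular_over\<close> only provides some entries;
  injectivity identifies them with the given ones, which thereby commute and have determinant
  1.\<close>

lemma inv_block_op_unimodular:
  assumes U: "clinear_op U" and Q: "unimodular_over U (block_op (mat2 a b c e))"
    and zero: "a 0 = 0" "b 0 = 0" "c 0 = 0" "e 0 = 0"
  shows "inv (block_op (mat2 a b c e)) = block_op (mat2 e (\<lambda>x. - b x) (\<lambda>x. - c x) a)"
proof -
  from Q obtain a' b' c' e' where
    eq: "block_op (mat2 a b c e) = block_op (mat2 a' b' c' e')"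
    and det': "\<And>x. a' (e' x) - b' (c' x) = x"
    and m': "a' \<in> bicommutant U" "b' \<in> bicommutant U" "c' \<in> bicommutant U" "e' \<in> bicommutant U"
    unfolding unimodular_over_def by blast
  have "a = a' \<and> b = b' \<and> c = c' \<and> e = e'"
    by (rule block_op_mat2_inject[OF eq])
      (use zero m'[THEN bicommutant_clinear, THEN clinear_op_zero] in auto)
  with m' det' have m: "a \<in> bicommutant U" "b \<in> bicommutant U" "c \<in> bicommutant U"
      "e \<in> bicommutant U"
    and det: "\<And>x. a (e x) - b (c x) = x" by auto
  note l = m[THEN bicommutant_clinear]
  note lin = l[THEN clinear_op_diff] l[THEN clinear_op_minus]
  note comm = bicommutant_commute[OF U]
  have comms: "e (a x) = a (e x)" "c (b x) = b (c x)" "b (a x) = a (b x)" "c (a x) = a (c x)"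
    "e (b x) = b (e x)" "e (c x) = c (e x)" for x
    using comm m by blast+
  \<comment> \<open>The determinant identity is oriented to eliminate \<open>a (e x)\<close>, the
    form to which \<open>comms\<close> brings the diagonal products.\<close>
  have det2: "a (e x) = x + b (c x)" for x
    using det[of x] by (simp add: algebra_simps)
  show ?thesis
  proof (rule inv_unique_comp)
    show "block_op (mat2 a b c e) \<circ> block_op (mat2 e (\<lambda>x. - b x) (\<lambda>x. - c x) a) = id"
      by (rule ext) (simp add: block_op_mat2 vec2_def vec_eq_iff forall_2 lin l[THEN clinear_op_add] comms det2)
    show "block_op (mat2 e (\<lambda>x. - b x) (\<lambda>x. - c x) a) \<circ> block_op (mat2 a b c e) = id"
      by (rule ext) (simp add: block_op_mat2 vec2_def vec_eq_iff forall_2 lin l[THEN clinear_op_add] comms det2)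
  qed
qed

section \<open>Laurent polynomials of an operator\<close>

lemma qsp_index_altdef: "qsp_index d = (\<lambda>k. 2 * int k - int d) ` {..d}"
  by (auto simp: qsp_index_def)

lemma card_qsp_index: "card (qsp_index d) = d + 1"
  unfolding qsp_index_altdef by (subst card_image) (auto simp: inj_on_def)

lemma uminus_mem_qsp_index: "n \<in> qsp_index d \<Longrightarrow> - n \<in> qsp_index d"
proof -
  assume "n \<in> qsp_index d"
  then obtain k where "k \<le> d" "n = 2 * int k - int d" by (auto simp: qsp_index_def)
  then have "- n = 2 * int (d - k) - int d" "d - k \<le> d" by auto
  then show ?thesis unfolding qsp_index_def by blast
qed

lemma op_powi_inv: "bij U \<Longrightarrow> op_powi (inv U) n = op_powi U (- n)"
  by (auto simp: op_powi_def inv_inv_eq)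

lemma clinear_op_powi: "clinear_op U \<Longrightarrow> bij U \<Longrightarrow> clinear_op (op_powi U n)"
  by (simp add: op_powi_def clinear_op_funpow clinear_op_inv)

text \<open>The index set is symmetric, so \<open>n\<close> can be replaced by \<open>- n\<close> in
  the sum. Each block entry can thus be expanded in \<open>\<omega>\<close> or in its inverse, as
  its position requires.\<close>

lemma laurent_inv:
  assumes "bij U"
  shows "laurent d f (inv U) = laurent d (\<lambda>n. f (- n)) U"
proof
  fix \<psi>
  show "laurent d f (inv U) \<psi> = laurent d (\<lambda>n. f (- n)) U \<psi>"
    unfolding laurent_def op_powi_inv[OF assms]
    by (rule sum.reindex_bij_witness[of _ uminus uminus]) (auto simp: uminus_mem_qsp_index)
qed

lemma clinear_laurent:
  assumes "clinear_op U" "bij U"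
  shows "clinear_op (laurent d f U)"
proof -
  note l = clinear_op_powi[OF assms]
  show ?thesis
    unfolding clinear_op_def laurent_def scaleR_L2_def
    by (simp add: clinear_op_add[OF l] clinear_op_scaleC[OF l] scaleC_add_right scaleC_scaleC
        scaleC_sum_right sum.distrib mult.commute)
qed

text \<open>The left factor is expanded in \<open>inv \<omega>\<close>, whose \<open>n\<close>-th
  power is the left factor of \<open>S_elem\<close>. Linearity pulls out both sums and all
  coefficients.\<close>

lemma laurent_sandwich:
  assumes \<omega>: "clinear_op \<omega>" "bij \<omega>" and S: "clinear_op S"
  shows "laurent d u (inv \<omega>) (S (laurent d v \<omega> \<psi>)) =
    (\<Sum>(n, m)\<in>qsp_index d \<times> qsp_index d. of_real (u n * v m) *\<^sub>C S_elem \<omega> S n m \<psi>)"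
proof -
  note l = clinear_op_powi[OF \<omega>]
  show ?thesis
    unfolding laurent_def scaleR_L2_def S_elem_def op_powi_inv[OF \<omega>(2)]
    by (simp add: clinear_op_sum[OF S] clinear_op_sum[OF l] clinear_op_scaleC[OF S]
        clinear_op_scaleC[OF l] scaleC_sum_right scaleC_scaleC sum.cartesian_product)
qed

section \<open>Conjugation of the oscillator unitary by the protocol\<close>

lemma tensor_op_mat_1: "tensor_op (mat 1) U \<Psi> = vec2 (U (\<Psi> $ 1)) (U (\<Psi> $ 2))"
  by (simp add: tensor_op_def block_op_def mat_def vec2_def vec_eq_iff forall_2 sum_2
      scaleC_one scaleC_zero_left)

theorem theorem3:
  fixes h :: unbounded_op and \<omega> :: "L2 \<Rightarrow> L2" and d :: nat and \<theta> :: "nat \<Rightarrow> real"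
    and f g :: "int \<Rightarrow> real"
    and h_poly :: "real \<Rightarrow> quadrature list \<Rightarrow> complex"
    and H :: "real \<Rightarrow> unbounded_op" and S :: "real \<Rightarrow> L2 \<Rightarrow> L2" and \<beta> :: real
  assumes h_self_adjoint: "self_adjoint h"
    and h_analytic: "analytic_in_quadratures h"
    and omega: "has_op_exp (op_scaleC (- \<i>) h) \<omega>"
    and d: "d > 0"
    and block_form: "qsp \<theta> \<omega> d = qsp_block_form d f g \<omega>"
    and h_beta: "\<And>b. hermitian_polynomial (h_poly b)"
    and H: "\<And>b. self_adjoint (H b)" "\<And>b. quadrature_series (h_poly b) \<subseteq> H b"
    and S_beta: "\<And>b. has_op_exp (op_scaleC \<i> (H b)) (S b)"
  shows "inv (qsp \<theta> \<omega> d) \<circ> tensor_op (mat 1) (S \<beta>) \<circ> qsp \<theta> \<omega> d =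
           (\<lambda>\<Psi>. \<Sum>(n, m)\<in>qsp_index d \<times> qsp_index d.
              tensor_op (C_mat f g n m) (S_elem \<omega> (S \<beta>) n m) \<Psi>)
         \<and> card (qsp_index d \<times> qsp_index d) = (d + 1)\<^sup>2"
proof
  show "card (qsp_index d \<times> qsp_index d) = (d + 1)\<^sup>2"
    by (simp add: card_cartesian_product card_qsp_index power2_eq_square)
  note lin = has_op_exp_clinear[OF omega] and bij = has_op_exp_bij[OF omega]
  note S = has_op_exp_clinear[OF S_beta[of \<beta>]]
  define F F' G G' where "F = laurent d f \<omega>" and "F' = laurent d f (inv \<omega>)"
    and "G = laurent d g \<omega>" and "G' = laurent d g (inv \<omega>)"
  have clin: "clinear_op F" "clinear_op F'" "clinear_op G" "clinear_op G'"
    using lin bij by (auto simp: F_def F'_def G_def G'_def laurent_inv clinear_laurent)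
  define f' g' where "f' = (\<lambda>n. f (- n))" and "g' = (\<lambda>n. g (- n))"
  \<comment> \<open>Every entry is expanded twice: \<open>left\<close> for its use before
    \<open>S \<beta>\<close>, \<open>right\<close> for its use after it. The reversed coefficients
    \<open>f'\<close> and \<open>g'\<close> are the source of the negated indices in
    \<open>C_mat\<close>.\<close>
  have left: "F = laurent d f' (inv \<omega>)" "F' = laurent d f (inv \<omega>)"
      "G = laurent d g' (inv \<omega>)" "G' = laurent d g (inv \<omega>)"
    and right: "F = laurent d f \<omega>" "F' = laurent d f' \<omega>" "G = laurent d g \<omega>" "G' = laurent d g' \<omega>"
    by (auto simp: F_def F'_def G_def G'_def f'_def g'_def laurent_inv[OF bij])
  let ?Q = "block_op (mat2 F (\<lambda>x. \<i> *\<^sub>C G x) (\<lambda>x. \<i> *\<^sub>C G' x) F')"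
  have Q: "qsp \<theta> \<omega> d = ?Q"
    unfolding block_form qsp_block_form_def F_def F'_def G_def G'_def ..
  \<comment> \<open>Determinant 1 comes from the factorization of \<open>qsp\<close>, and
    \<open>Q\<close> transfers it to the given block form.\<close>
  have inv_Q: "inv ?Q = block_op (mat2 F' (\<lambda>x. - (\<i> *\<^sub>C G x)) (\<lambda>x. - (\<i> *\<^sub>C G' x)) F)"
    by (rule inv_block_op_unimodular[OF lin])
      (use unimodular_over_qsp[OF lin bij, of \<theta> d] Q clin[THEN clinear_op_zero] in
        \<open>auto simp: scaleC_zero_right\<close>)
  let ?I = "qsp_index d \<times> qsp_index d"
  let ?E = "\<lambda>c \<psi>. \<Sum>(n, m)\<in>?I. c n m *\<^sub>C S_elem \<omega> (S \<beta>) n m \<psi>"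
  have E_add: "?E c \<psi> + ?E c' \<psi> = ?E (\<lambda>n m. c n m + c' n m) \<psi>"
    and E_diff: "?E c \<psi> - ?E c' \<psi> = ?E (\<lambda>n m. c n m - c' n m) \<psi>"
    and E_scale: "\<i> *\<^sub>C ?E c \<psi> = ?E (\<lambda>n m. \<i> * c n m) \<psi>" for c c' \<psi>
    by (simp_all add: split_beta scaleC_add_left scaleC_diff_left scaleC_sum_right scaleC_scaleC
        sum.distrib sum_subtractf)
  note sandwich = laurent_sandwich[OF lin bij S, where d = d]
  \<comment> \<open>Two products for each of the four entries of the conjugated block operator, row
    by row.\<close>
  have products:
    "F' (S \<beta> (F \<psi>)) = ?E (\<lambda>n m. of_real (f n * f m)) \<psi>"
    "G (S \<beta> (G' \<psi>)) = ?E (\<lambda>n m. of_real (g' n * g' m)) \<psi>"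
    "F' (S \<beta> (G \<psi>)) = ?E (\<lambda>n m. of_real (f n * g m)) \<psi>"
    "G (S \<beta> (F' \<psi>)) = ?E (\<lambda>n m. of_real (g' n * f' m)) \<psi>"
    "F (S \<beta> (G' \<psi>)) = ?E (\<lambda>n m. of_real (f' n * g' m)) \<psi>"
    "G' (S \<beta> (F \<psi>)) = ?E (\<lambda>n m. of_real (g n * f m)) \<psi>"
    "G' (S \<beta> (G \<psi>)) = ?E (\<lambda>n m. of_real (g n * g m)) \<psi>"
    "F (S \<beta> (F' \<psi>)) = ?E (\<lambda>n m. of_real (f' n * f' m)) \<psi>"
    for \<psi>
    subgoal unfolding left(2) right(1) by (rule sandwich)
    subgoal unfolding left(3) right(4) by (rule sandwich)
    subgoal unfolding left(2) right(3) by (rule sandwich)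
    subgoal unfolding left(3) right(2) by (rule sandwich)
    subgoal unfolding left(1) right(4) by (rule sandwich)
    subgoal unfolding left(4) right(1) by (rule sandwich)
    subgoal unfolding left(4) right(3) by (rule sandwich)
    subgoal unfolding left(1) right(2) by (rule sandwich)
    done
  show "inv (qsp \<theta> \<omega> d) \<circ> tensor_op (mat 1) (S \<beta>) \<circ> qsp \<theta> \<omega> d =
    (\<lambda>\<Psi>. \<Sum>(n, m)\<in>?I. tensor_op (C_mat f g n m) (S_elem \<omega> (S \<beta>) n m) \<Psi>)"
  proof
    fix \<Psi> :: "L2 ^ 2"
    define x y where "x = \<Psi> $ 1" and "y = \<Psi> $ 2"
    let ?S = "S \<beta>"
    note simps = clin[THEN clinear_op_add] clin[THEN clinear_op_scaleC] S[THEN clinear_op_add]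
      S[THEN clinear_op_scaleC] scaleC_add_right scaleC_scaleC scaleC_minus_left scaleC_one
    \<comment> \<open>In the diagonal entries the factors \<open>- \<i>\<close> and
      \<open>\<i>\<close> multiply to 1, which gives the plus signs; off the diagonal a single
      \<open>\<i>\<close> remains in front of a difference.\<close>
    have "(inv ?Q \<circ> tensor_op (mat 1) ?S \<circ> ?Q) \<Psi> =
      vec2 ((F' (?S (F x)) + G (?S (G' x))) + \<i> *\<^sub>C (F' (?S (G y)) - G (?S (F' y))))
           (\<i> *\<^sub>C (F (?S (G' x)) - G' (?S (F x))) + (G' (?S (G y)) + F (?S (F' y))))"
      by (simp add: inv_Q block_op_mat2 tensor_op_mat_1 vec2_nth vec2_eq_iff flip: x_def y_def)
        (simp add: simps scaleC_diff_right algebra_simps)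
    also have "\<dots> = vec2
      (?E (\<lambda>n m. C_mat f g n m $ 1 $ 1) x + ?E (\<lambda>n m. C_mat f g n m $ 1 $ 2) y)
      (?E (\<lambda>n m. C_mat f g n m $ 2 $ 1) x + ?E (\<lambda>n m. C_mat f g n m $ 2 $ 2) y)"
      unfolding products E_add E_diff E_scale
      by (simp add: C_mat_def mat2_def f'_def g'_def algebra_simps)
    also have "\<dots> = (\<Sum>(n, m)\<in>?I. tensor_op (C_mat f g n m) (S_elem \<omega> ?S n m) \<Psi>)"
      by (simp add: tensor_op_def block_op_def vec2_def vec_eq_iff forall_2 sum_2 split_beta
          sum_component sum.distrib x_def y_def)
    finally show "(inv (qsp \<theta> \<omega> d) \<circ> tensor_op (mat 1) ?S \<circ> qsp \<theta> \<omega> d) \<Psi> =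
      (\<Sum>(n, m)\<in>?I. tensor_op (C_mat f g n m) (S_elem \<omega> ?S n m) \<Psi>)"
      unfolding Q .
  qed
qed

end
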